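(* Fix $i,j\in\{1,\dots,k\}$ and suppose the winsorizing proportions satisfy $0\le a=a_i=a_j\le1-b=1-b_i=1-b_j\le1$; write $\overline{a}=1-a$, $\overline{b}=1-b$. For $1\le s,t\le3$ let $$V_{st}=\int_0^1\left(\frac{1}{1-u}\right)^2\psi_s(i)\,\psi_t(j)\,du,$$ where $\psi_s(r)=\psi_s(r)(u)$ are the functions of $u$ given in the context, and for $x\in\{i,j\}$ let $\Delta_x=aH_x(a)+\int_a^{\overline{b}}H_x(v)\,dv+bH_x(\overline{b})$. Then $$\begin{aligned} V_{11}&=aH_i(a)H_j(a)+bH_i(\overline{b})H_j(\overline{b})+\int_a^{\overline{b}}H_i(v)H_j(v)\,dv-\Delta_i\,\Delta_j,\\ V_{12}&=a^2H_j'(a)\left[bH_i(\overline{b})-\overline{a}H_i(a)+\int_a^{\overline{b}}H_i(v)\,dv\right],\\ V_{13}&=b^2H_j'(\overline{b})\left[\overline{b}H_i(\overline{b})-aH_i(a)-\int_a^{\overline{b}}H_i(v)\,dv\right],\\ V_{21}&=a^2H_i'(a)\left[bH_j(\overline{b})-\overline{a}H_j(a)+\int_a^{\overline{b}}H_j(v)\,dv\right],\\ V_{22}&=a^3\,\overline{a}\,H_i'(a)H_j'(a),\qquad V_{23}=a^2b^2H_i'(a)H_j'(\overline{b}),\\ V_{31}&=b^2H_i'(\overline{b})\left[\overline{b}H_j(\overline{b})-aH_j(a)-\int_a^{\overline{b}}H_j(v)\,dv\right],\\ V_{32}&=a^2b^2H_j'(a)H_i'(\overline{b}),\qquad V_{33}=b^3\,\overline{b}\,H_i'(\overline{b})H_j'(\overline{b}).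 \end{aligned}$$
   Context: $F$ is a cumulative distribution function on the real line, with quantile function $F^{-1}(u)=\inf\{x:F(x)\ge u\}$. The $h_r$ are given real functions, and $H_r:=h_r\circ F^{-1}$. $H_r'$ is the derivative of $H_r$, with $H_r'(u)\,du=dh_r(F^{-1}(u))$. For $r\in\{i,j\}$, $H_r$ is taken to be finite and absolutely continuous on $[a,\overline{b}]$, so that integration by parts is valid, and $H_r'(a)$, $H_r'(\overline{b})$ exist and are finite. The winsorizing weights-generating function is $J_r(s)=1$ for $a_r<s<1-b_r$ and $J_r(s)=0$ otherwise, and $g_r(v)=J_r(v)H_r'(v)$. With $\mathbf{1}\{\cdot\}$ the indicator, for $r\in\{i,j\}$ and $u\in[0,1)$, $$\psi_1(r)(u)=\int_u^1(1-v)\,g_r(v)\,dv,$$ $$\psi_2(r)(u)=\mathbf{1}\{a_r\ge u\}\,a_r(1-a_r)\,H_r'(a_r),$$ $$\psi_3(r)(u)=\mathbf{1}\{1-b_r\ge u\}\,b_r^2\,H_r'(1-b_r).$$ In the paper, the asymptotic covariance of the winsorized moments is $\sigma_{ij}^2=\int_0^1\alpha_i(u)\alpha_j(u)\,du=\sum_{s,t=1}^3V_{st}$, where $\alpha_r(u)=\big(\psi_1(r)(u)+\psi_2(r)(u)+\psi_3(r)(u)\big)/(1-u)$. *)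

theory Defs
  imports "HOL-Probability.Probability"
begin

text \<open>
  The quantile function is extended-real valued, so that the infimum is always the true one:
  \<^term>\<open>F\<close> being a distribution function, its value is \<open>-\<infinity>\<close> at \<open>0\<close>, finite on
  \<open>(0,1)\<close>, and finite or \<open>\<infinity>\<close> at \<open>1\<close>.
\<close>

definition quantile :: "(real \<Rightarrow> real) \<Rightarrow> real \<Rightarrow> ereal" where
  "quantile F u = Inf {ereal x | x. F x \<ge> u}"

text \<open>
  The composition of \<open>h\<close> with the quantile function. Where the quantile is infinite (only at the
  endpoints \<open>0\<close> and possibly \<open>1\<close> of the unit interval) the composition is read as the one-sided
  limit from inside \<open>(0,1)\<close>.
\<close>

definition qcomp :: "(real \<Rightarrow> real) \<Rightarrow> (real \<Rightarrow> real) \<Rightarrow> real \<Rightarrow> real" where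
  "qcomp F h u =
     (if \<bar>quantile F u\<bar> \<noteq> \<infinity> then h (real_of_ereal (quantile F u))
      else Lim (at u within {0<..<1}) (\<lambda>v. h (real_of_ereal (quantile F v))))"

text \<open>
  Absolute continuity of a real function (the library constant \<^const>\<open>absolutely_continuous\<close> is the
  unrelated notion for measures).
\<close>

definition abs_continuous_on :: "real set \<Rightarrow> (real \<Rightarrow> real) \<Rightarrow> bool" where
  "abs_continuous_on S f \<longleftrightarrow>
     (\<forall>\<epsilon>>0. \<exists>\<delta>>0. \<forall>(n::nat) x y.
        (\<forall>k<n. x k \<le> y k \<and> {x k..y k} \<subseteq> S) \<longrightarrow>
        (\<forall>k<n. \<forall>l<n. k \<noteq> l \<longrightarrow> {x k<..<y k} \<inter> {x l<..<y l} = {}) \<longrightarrow>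
        (\<Sum>k<n. y k - x k) < \<delta> \<longrightarrow>
        (\<Sum>k<n. \<bar>f (y k) - f (x k)\<bar>) < \<epsilon>)"

definition wins_weight :: "real \<Rightarrow> real \<Rightarrow> real \<Rightarrow> real" where
  "wins_weight a b s = (if a < s \<and> s < 1 - b then 1 else 0)"

text \<open>
  In the following, \<open>D\<close> is the derivative of the composition \<^const>\<open>qcomp\<close>; it matters only up to
  null sets and at \<open>a\<close> and \<open>1 - b\<close>. The integrals are over \<^const>\<open>lebesgue\<close> rather than
  \<^const>\<open>lborel\<close> because \<open>D\<close> is unconstrained on a null set, so it need not be Borel measurable.
\<close>

definition psi1 :: "real \<Rightarrow> real \<Rightarrow> (real \<Rightarrow> real) \<Rightarrow> real \<Rightarrow> real" where
  "psi1 a b D u = (LINT v:{u..1}|lebesgue. (1 - v) * (wins_weight a b v * D v))"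

definition psi2 :: "real \<Rightarrow> real \<Rightarrow> (real \<Rightarrow> real) \<Rightarrow> real \<Rightarrow> real" where
  "psi2 a b D u = (if a \<ge> u then 1 else 0) * (a * (1 - a) * D a)"

definition psi3 :: "real \<Rightarrow> real \<Rightarrow> (real \<Rightarrow> real) \<Rightarrow> real \<Rightarrow> real" where
  "psi3 a b D u = (if 1 - b \<ge> u then 1 else 0) * (b\<^sup>2 * D (1 - b))"

definition psi :: "nat \<Rightarrow> real \<Rightarrow> real \<Rightarrow> (real \<Rightarrow> real) \<Rightarrow> real \<Rightarrow> real" where
  "psi s = (if s = 1 then psi1 else if s = 2 then psi2 else psi3)"

definition V_integrand :: "(real \<Rightarrow> real) \<Rightarrow> (real \<Rightarrow> real) \<Rightarrow> real \<Rightarrow> real" where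
  "V_integrand p q u = (1 / (1 - u))\<^sup>2 * p u * q u"

definition V_integral :: "(real \<Rightarrow> real) \<Rightarrow> (real \<Rightarrow> real) \<Rightarrow> real" where
  "V_integral p q = (LINT u:{0..<1}|lebesgue. V_integrand p q u)"

definition wins_mean :: "real \<Rightarrow> real \<Rightarrow> (real \<Rightarrow> real) \<Rightarrow> real" where
  "wins_mean a b H = a * H a + (LINT v:{a..1 - b}|lebesgue. H v) + b * H (1 - b)"

end

theory Submission
  imports Defs
begin

text \<open>
  Let \<open>c = 1 - b\<close> and \<open>K\<^sub>r(u) = b H\<^sub>r(c) + \<integral>\<^sub>u\<^sup>c H\<^sub>r\<close>, so that \<open>K\<^sub>r' = - H\<^sub>r\<close>. Integration by parts gives
  \<open>\<psi>\<^sub>1(r)(u) = K\<^sub>r(u) - (1 - u) H\<^sub>r(u) = K\<^sub>r(u) + (1 - u) K\<^sub>r'(u)\<close> on \<open>[a, c]\<close>, while \<open>\<psi>\<^sub>1(r)\<close> is constant on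
  \<open>[0, a]\<close> and vanishes beyond \<open>c\<close>. Hence on \<open>[a, c]\<close>
  \<open>\<psi>\<^sub>1(i) \<psi>\<^sub>1(j) / (1 - u)\<^sup>2 = (K\<^sub>i K\<^sub>j / (1 - u))' + H\<^sub>i H\<^sub>j\<close> and
  \<open>\<psi>\<^sub>1(i) / (1 - u)\<^sup>2 = (K\<^sub>i / (1 - u))'\<close>, which need no differentiability of \<open>H\<^sub>r\<close>.
  The integration by parts rests on the fundamental theorem of calculus for absolutely continuous
  functions: it holds for the gauge integral, and bounded variation gives Lebesgue integrability of
  the derivative.
\<close>

subsection \<open>Absolutely continuous functions\<close>

text \<open>The index set is arbitrary because gauge divisions come indexed by pairs (tag, interval)
  or by the intervals themselves. Only the open intervals are disjoint, so neighbours in a division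
  may share an endpoint.\<close>

definition nonoverlapping_in :: "real set \<Rightarrow> 'i set \<Rightarrow> ('i \<Rightarrow> real) \<Rightarrow> ('i \<Rightarrow> real) \<Rightarrow> bool" where
  "nonoverlapping_in S I x y \<longleftrightarrow>
     (\<forall>k\<in>I. x k \<le> y k \<and> {x k..y k} \<subseteq> S) \<and>
     (\<forall>k\<in>I. \<forall>l\<in>I. k \<noteq> l \<longrightarrow> {x k<..<y k} \<inter> {x l<..<y l} = {})"

lemma nonoverlapping_in_mono:
  "nonoverlapping_in S I x y \<Longrightarrow> S \<subseteq> T \<Longrightarrow> nonoverlapping_in T I x y"
  unfolding nonoverlapping_in_def by (simp add: Ball_def) (meson order_trans subset_trans)

lemma abs_continuous_on_iff_nonoverlapping:
  "abs_continuous_on S f \<longleftrightarrow>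
     (\<forall>\<epsilon>>0. \<exists>\<delta>>0. \<forall>(n::nat) x y. nonoverlapping_in S {..<n} x y \<longrightarrow>
        (\<Sum>k<n. y k - x k) < \<delta> \<longrightarrow> (\<Sum>k<n. \<bar>f (y k) - f (x k)\<bar>) < \<epsilon>)"
  unfolding abs_continuous_on_def nonoverlapping_in_def by (simp add: Ball_def imp_conjL)

text \<open>Enumerating \<open>I\<close> by \<open>{..<card I}\<close> turns a finite family into
  one of the sequences in the definition of absolute continuity, and neither sum changes. The same
  \<delta> therefore works for all finite families.\<close>

lemma abs_continuous_on_finite_family:
  assumes "abs_continuous_on S f" and "\<epsilon> > 0"
  shows "\<exists>\<delta>>0. \<forall>(I :: 'i set) x y. finite I \<longrightarrow> nonoverlapping_in S I x y \<longrightarrow>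
      (\<Sum>k\<in>I. y k - x k) < \<delta> \<longrightarrow> (\<Sum>k\<in>I. \<bar>f (y k) - f (x k)\<bar>) < \<epsilon>"
proof -
  obtain \<delta> where "\<delta> > 0" and \<delta>: "\<And>(n::nat) x y. nonoverlapping_in S {..<n} x y \<Longrightarrow>
        (\<Sum>k<n. y k - x k) < \<delta> \<Longrightarrow> (\<Sum>k<n. \<bar>f (y k) - f (x k)\<bar>) < \<epsilon>"
    using assms unfolding abs_continuous_on_iff_nonoverlapping by blast
  have "(\<Sum>k\<in>I. \<bar>f (y k) - f (x k)\<bar>) < \<epsilon>"
    if "finite I" and I: "nonoverlapping_in S I x y" and less: "(\<Sum>k\<in>I. y k - x k) < \<delta>"
    for I :: "'i set" and x y
  proof -
    obtain g where g: "bij_betw g {..<card I} I"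
      using \<open>finite I\<close> by (metis atLeast0LessThan ex_bij_betw_nat_finite)
    have gI: "g k \<in> I" if "k < card I" for k
      using g that by (auto simp: bij_betw_def)
    have g_inj: "g k = g l \<longleftrightarrow> k = l" if "k < card I" "l < card I" for k l
      using g that by (auto simp: bij_betw_def inj_on_def)
    have "(\<Sum>k<card I. \<bar>f (y (g k)) - f (x (g k))\<bar>) < \<epsilon>"
    proof (rule \<delta>)
      show "nonoverlapping_in S {..<card I} (\<lambda>k. x (g k)) (\<lambda>k. y (g k))"
        using I gI g_inj by (simp add: nonoverlapping_in_def)
      show "(\<Sum>k<card I. y (g k) - x (g k)) < \<delta>"
        using less sum.reindex_bij_betw[OF g, of "\<lambda>k. y k - x k"] by simp
    qed
    then show ?thesis
      using sum.reindex_bij_betw[OF g, of "\<lambda>k. \<bar>f (y k) - f (x k)\<bar>"] by simp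
  qed
  with \<open>\<delta> > 0\<close> show ?thesis by blast
qed

lemma abs_continuous_on_subset:
  assumes "abs_continuous_on S f" and "T \<subseteq> S"
  shows "abs_continuous_on T f"
  using assms nonoverlapping_in_mono unfolding abs_continuous_on_iff_nonoverlapping by meson

text \<open>Continuity is the case of a single interval, here a family indexed by the unit
  type.\<close>

lemma abs_continuous_on_imp_continuous_on:
  assumes "abs_continuous_on {a..b} f"
  shows "continuous_on {a..b} f"
  unfolding continuous_on_iff
proof (intro ballI allI impI)
  fix x \<epsilon> :: real
  assume x: "x \<in> {a..b}" and "\<epsilon> > 0"
  obtain \<delta> where "\<delta> > 0"
    and \<delta>: "\<And>(I :: unit set) x y. finite I \<Longrightarrow> nonoverlapping_in {a..b} I x y \<Longrightarrow>
      (\<Sum>k\<in>I. y k - x k) < \<delta> \<Longrightarrow> (\<Sum>k\<in>I. \<bar>f (y k) - f (x k)\<bar>) < \<epsilon>"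
    using abs_continuous_on_finite_family[OF assms \<open>\<epsilon> > 0\<close>] by blast
  have *: "\<bar>f v - f u\<bar> < \<epsilon>" if "u \<le> v" "u \<in> {a..b}" "v \<in> {a..b}" "v - u < \<delta>" for u v
    using \<delta>[of "{()}" "\<lambda>_. u" "\<lambda>_. v"] that by (auto simp: nonoverlapping_in_def)
  show "\<exists>d>0. \<forall>x'\<in>{a..b}. dist x' x < d \<longrightarrow> dist (f x') (f x) < \<epsilon>"
  proof (intro exI[of _ \<delta>] conjI ballI impI)
    fix x' assume "x' \<in> {a..b}" "dist x' x < \<delta>"
    then show "dist (f x') (f x) < \<epsilon>"
      using *[of x x'] *[of x' x] x by (cases "x \<le> x'") (auto simp: dist_real_def)
  qed fact
qed

text \<open>Both factors are continuous, hence bounded on the compact interval. An increment of the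
  product is then at most a bound for one factor times the increment of the other, plus the
  symmetric term.\<close>

lemma abs_continuous_on_mult:
  assumes f: "abs_continuous_on {a..b} f" and g: "abs_continuous_on {a..b} g"
  shows "abs_continuous_on {a..b} (\<lambda>x. f x * g x)"
proof -
  have "\<exists>B>0. \<forall>x\<in>{a..b}. \<bar>p x\<bar> \<le> B" if "abs_continuous_on {a..b} p" for p
    using compact_imp_bounded[OF compact_continuous_image[OF
        abs_continuous_on_imp_continuous_on[OF that] compact_Icc]]
    by (auto simp: bounded_pos)
  then obtain B C where "B > 0" "C > 0"
    and B: "\<And>x. x \<in> {a..b} \<Longrightarrow> \<bar>f x\<bar> \<le> B" and C: "\<And>x. x \<in> {a..b} \<Longrightarrow> \<bar>g x\<bar> \<le> C"
    using f g by metis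
  show ?thesis
    unfolding abs_continuous_on_iff_nonoverlapping
  proof (intro allI impI)
    fix \<epsilon> :: real assume "\<epsilon> > 0"
    \<comment> \<open>The increments of \<open>f\<close> get weighted by the bound \<open>C\<close>
      of \<open>g\<close>, and those of \<open>g\<close> by the bound \<open>B\<close> of
      \<open>f\<close>. With these tolerances each part contributes less than \<epsilon>/2.\<close>
    have pos: "\<epsilon> / (2 * C) > 0" "\<epsilon> / (2 * B) > 0"
      using \<open>\<epsilon> > 0\<close> \<open>B > 0\<close> \<open>C > 0\<close> by auto
    obtain \<delta>1 where "\<delta>1 > 0"
      and \<delta>1: "\<And>(n::nat) x y. nonoverlapping_in {a..b} {..<n} x y \<Longrightarrow>
        (\<Sum>k<n. y k - x k) < \<delta>1 \<Longrightarrow> (\<Sum>k<n. \<bar>f (y k) - f (x k)\<bar>) < \<epsilon> / (2 * C)"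
      using f pos(1) unfolding abs_continuous_on_iff_nonoverlapping by blast
    obtain \<delta>2 where "\<delta>2 > 0"
      and \<delta>2: "\<And>(n::nat) x y. nonoverlapping_in {a..b} {..<n} x y \<Longrightarrow>
        (\<Sum>k<n. y k - x k) < \<delta>2 \<Longrightarrow> (\<Sum>k<n. \<bar>g (y k) - g (x k)\<bar>) < \<epsilon> / (2 * B)"
      using g pos(2) unfolding abs_continuous_on_iff_nonoverlapping by blast
    show "\<exists>\<delta>>0. \<forall>(n::nat) x y. nonoverlapping_in {a..b} {..<n} x y \<longrightarrow>
        (\<Sum>k<n. y k - x k) < \<delta> \<longrightarrow>
        (\<Sum>k<n. \<bar>f (y k) * g (y k) - f (x k) * g (x k)\<bar>) < \<epsilon>"
    proof (intro exI[of _ "min \<delta>1 \<delta>2"] conjI allI impI)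
      fix n :: nat and x y
      assume *: "nonoverlapping_in {a..b} {..<n} x y"
        and less: "(\<Sum>k<n. y k - x k) < min \<delta>1 \<delta>2"
      have "(\<Sum>k<n. \<bar>f (y k) * g (y k) - f (x k) * g (x k)\<bar>)
          \<le> (\<Sum>k<n. B * \<bar>g (y k) - g (x k)\<bar> + C * \<bar>f (y k) - f (x k)\<bar>)"
      proof (rule sum_mono)
        fix k assume "k \<in> {..<n}"
        with * have "x k \<le> y k" "{x k..y k} \<subseteq> {a..b}"
          unfolding nonoverlapping_in_def by blast+
        then have xy: "x k \<in> {a..b}" "y k \<in> {a..b}" by auto
        have "f (y k) * g (y k) - f (x k) * g (x k)
            = f (y k) * (g (y k) - g (x k)) + g (x k) * (f (y k) - f (x k))"
          by (simp add: algebra_simps)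
        also have "\<bar>\<dots>\<bar> \<le> \<bar>f (y k)\<bar> * \<bar>g (y k) - g (x k)\<bar> + \<bar>g (x k)\<bar> * \<bar>f (y k) - f (x k)\<bar>"
          by (metis abs_mult abs_triangle_ineq)
        also have "\<dots> \<le> B * \<bar>g (y k) - g (x k)\<bar> + C * \<bar>f (y k) - f (x k)\<bar>"
          using B C xy by (intro add_mono mult_right_mono) auto
        finally show "\<bar>f (y k) * g (y k) - f (x k) * g (x k)\<bar>
            \<le> B * \<bar>g (y k) - g (x k)\<bar> + C * \<bar>f (y k) - f (x k)\<bar>" .
      qed
      also have "\<dots> = B * (\<Sum>k<n. \<bar>g (y k) - g (x k)\<bar>) + C * (\<Sum>k<n. \<bar>f (y k) - f (x k)\<bar>)"
        by (simp add: sum.distrib sum_distrib_left)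
      also have "\<dots> < B * (\<epsilon> / (2 * B)) + C * (\<epsilon> / (2 * C))"
        using \<delta>1[OF *] \<delta>2[OF *] less \<open>B > 0\<close> \<open>C > 0\<close>
        by (intro add_strict_mono mult_strict_left_mono) auto
      also have "\<dots> = \<epsilon>"
        using \<open>B > 0\<close> \<open>C > 0\<close> by simp
      finally show "(\<Sum>k<n. \<bar>f (y k) * g (y k) - f (x k) * g (x k)\<bar>) < \<epsilon>" .
    qed (use \<open>\<delta>1 > 0\<close> \<open>\<delta>2 > 0\<close> in auto)
  qed
qed

lemma abs_continuous_on_one_minus: "abs_continuous_on S (\<lambda>x. 1 - x)"
  unfolding abs_continuous_on_iff_nonoverlapping
proof (intro allI impI)
  fix \<epsilon> :: real assume "\<epsilon> > 0"
  have "(\<Sum>k<n. \<bar>1 - y k - (1 - x k)\<bar>) = (\<Sum>k<n. y k - x k)"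
    if "nonoverlapping_in S {..<n} x y" for n :: nat and x y
    using that by (intro sum.cong) (auto simp: nonoverlapping_in_def)
  with \<open>\<epsilon> > 0\<close> show "\<exists>\<delta>>0. \<forall>(n::nat) x y. nonoverlapping_in S {..<n} x y \<longrightarrow>
      (\<Sum>k<n. y k - x k) < \<delta> \<longrightarrow> (\<Sum>k<n. \<bar>1 - y k - (1 - x k)\<bar>) < \<epsilon>"
    by (intro exI[of _ \<epsilon>]) simp
qed

section \<open>The fundamental theorem of calculus for absolutely continuous functions\<close>

text \<open>Removing endpoints does not change lengths, and the open intervals are disjoint subsets
  of \<open>U\<close>, so finite additivity and monotonicity of the measure apply.\<close>

lemma nonoverlapping_in_sum_le_measure:
  assumes "finite I" and I: "nonoverlapping_in U I x y" and U: "U \<in> lmeasurable"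
  shows "(\<Sum>k\<in>I. y k - x k) \<le> measure lebesgue U"
proof -
  have sub: "{x k<..<y k} \<subseteq> U" if "k \<in> I" for k
    using I that greaterThanLessThan_subseteq_atLeastAtMost_iff
    unfolding nonoverlapping_in_def by force
  have "(\<Sum>k\<in>I. y k - x k) = (\<Sum>k\<in>I. measure lebesgue {x k<..<y k})"
    using I by (intro sum.cong) (auto simp: nonoverlapping_in_def)
  also have "\<dots> = measure lebesgue (\<Union>k\<in>I. {x k<..<y k})"
    using \<open>finite I\<close> I
    by (intro measure_finite_Union[symmetric]) (auto simp: disjoint_family_on_def nonoverlapping_in_def)
  also have "\<dots> \<le> measure lebesgue U"
    using sub U \<open>finite I\<close> by (intro measure_mono_fmeasurable) auto
  finally show ?thesis .
qed

text \<open>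
  On the exceptional null set the gauge keeps the intervals inside an open set of small measure, so
  that absolute continuity controls their total increment.
\<close>

lemma has_integral_abs_continuous:
  fixes f D :: "real \<Rightarrow> real"
  assumes "a \<le> b" and ac: "abs_continuous_on {a..b} f" and "negligible S"
    and deriv: "\<And>x. x \<in> {a<..<b} - S \<Longrightarrow> (f has_real_derivative D x) (at x)"
  shows "(D has_integral (f b - f a)) {a..b}"
proof (cases "a = b")
  case True
  then show ?thesis by (simp add: has_integral_refl)
next
  case False
  with \<open>a \<le> b\<close> have "a < b" by simp
  \<comment> \<open>The endpoints join the exceptional set because the derivative is given only in
    the open interval.\<close>
  define T where "T = S \<union> {a, b}"
  have T: "negligible T"
    using \<open>negligible S\<close> by (simp add: T_def negligible_Un negligible_insert)
  \<comment> \<open>Setting the integrand to 0 on \<open>T\<close> leaves only the increment of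
    \<open>f\<close> to estimate at an exceptional tag. The spike at the end of the proof returns to
    \<open>D\<close>.\<close>
  define D0 where "D0 x = (if x \<in> T then 0 else D x)" for x
  have "(D0 has_integral (f b - f a)) {a..b}"
    unfolding has_integral_real
  proof (intro allI impI)
    fix e :: real assume "e > 0"
    \<comment> \<open>The error budget is split in two: ordinary tags cost at most
      \<open>e' * (b - a)\<close>, which is \<open>e / 2\<close>, and exceptional tags cost less
      than \<open>e / 2\<close>.\<close>
    define e' where "e' = e / (2 * (b - a))"
    have "e' > 0" using \<open>e > 0\<close> \<open>a < b\<close> by (simp add: e'_def)
    have "e / 2 > 0" using \<open>e > 0\<close> by simp
    then obtain \<delta> where "\<delta> > 0"
      and \<delta>: "\<And>(I :: (real \<times> real set) set) x y. finite I \<Longrightarrow> nonoverlapping_in {a..b} I x y \<Longrightarrow>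
        (\<Sum>k\<in>I. y k - x k) < \<delta> \<Longrightarrow> (\<Sum>k\<in>I. \<bar>f (y k) - f (x k)\<bar>) < e / 2"
      using abs_continuous_on_finite_family[OF ac] by blast
    have "T \<in> sets lebesgue" using T by (rule negligible_imp_sets)
    \<comment> \<open>Since \<open>T\<close> is null, an open superset exceeding it by measure less
      than \<delta> has itself measure less than \<delta>.\<close>
    then obtain U where "open U" "T \<subseteq> U" and UT: "U - T \<in> lmeasurable"
      "emeasure lebesgue (U - T) < ennreal \<delta>"
      using sets_lebesgue_outer_open \<open>\<delta> > 0\<close> by metis
    have U: "U \<in> lmeasurable"
    proof -
      have "(U - T) \<union> T \<in> lmeasurable"
        using UT(1) T by (intro fmeasurable.Un) (auto simp: negligible_imp_measurable)
      with \<open>T \<subseteq> U\<close> show ?thesis by (simp add: Un_absorb2)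
    qed
    have "measure lebesgue U = measure lebesgue (U - T)"
      using T \<open>open U\<close> by (intro measure_Diff_null_set[symmetric])
        (auto simp: negligible_iff_null_sets)
    then have mU: "measure lebesgue U < \<delta>"
      using UT by (simp add: emeasure_eq_measure2 ennreal_less_iff)
    \<comment> \<open>The radius of the gauge: at an exceptional point the ball stays in
      \<open>U\<close>, and at an ordinary point of the interval the linear approximation of
      \<open>f\<close> is accurate up to the factor \<open>e'\<close>.\<close>
    have "\<exists>r>0. (x \<in> T \<longrightarrow> ball x r \<subseteq> U) \<and> (x \<in> {a..b} - T \<longrightarrow>
        (\<forall>y. \<bar>y - x\<bar> < r \<longrightarrow> \<bar>f y - f x - (y - x) * D x\<bar> \<le> e' * \<bar>y - x\<bar>))" for x
    proof (cases "x \<in> T")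
      case True
      then show ?thesis
        using \<open>open U\<close> \<open>T \<subseteq> U\<close> by (meson DiffD2 open_contains_ball subsetD)
    next
      case xT: False
      show ?thesis
      proof (cases "x \<in> {a..b}")
        case True
        with xT have "(f has_real_derivative D x) (at x)"
          by (intro deriv) (auto simp: T_def less_le)
        then have "(f has_derivative (\<lambda>h. D x * h)) (at x)"
          by (simp add: has_field_derivative_def)
        then show ?thesis
          using \<open>e' > 0\<close> xT unfolding has_derivative_at_alt
          by (simp add: mult.commute) blast
      qed (use xT in \<open>auto intro: exI[of _ 1]\<close>)
    qed
    then obtain r where r: "\<And>x. r x > 0" "\<And>x. x \<in> T \<Longrightarrow> ball x (r x) \<subseteq> U"
      "\<And>x y. x \<in> {a..b} - T \<Longrightarrow> \<bar>y - x\<bar> < r x \<Longrightarrow> \<bar>f y - f x - (y - x) * D x\<bar> \<le> e' * \<bar>y - x\<bar>"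
      by metis
    show "\<exists>\<gamma>. gauge \<gamma> \<and> (\<forall>\<D>. \<D> tagged_division_of {a..b} \<and> \<gamma> fine \<D> \<longrightarrow>
        norm ((\<Sum>(x, K)\<in>\<D>. measure lborel K *\<^sub>R D0 x) - (f b - f a)) < e)"
    proof (intro exI[of _ "\<lambda>x. ball x (r x)"] conjI allI impI)
      show "gauge (\<lambda>x. ball x (r x))"
        using r(1) by (intro gauge_ball_dependent) auto
    next
      fix p
      assume "p tagged_division_of {a..b} \<and> (\<lambda>x. ball x (r x)) fine p"
      then have p: "p tagged_division_of {a..b}" and fine: "(\<lambda>x. ball x (r x)) fine p"
        by auto
      note p' = tagged_division_ofD[OF p]
      have K: "K = {Inf K..Sup K} \<and> Inf K \<le> x \<and> x \<le> Sup K \<and> K \<subseteq> {a..b} \<and> K \<subseteq> ball x (r x)"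
        if xK: "(x, K) \<in> p" for x K
      proof -
        obtain u v where "K = cbox u v" using p'(4)[OF xK] by blast
        moreover have "x \<in> K" using p'(2)[OF xK] .
        ultimately show ?thesis
          using p'(3)[OF xK] fineD[OF fine xK] by auto
      qed
      define q where "q = {z \<in> p. fst z \<in> T}"
      have "finite q" "q \<subseteq> p" using p'(1) by (auto simp: q_def)
      have bound: "\<bar>measure lborel K * D0 x - (f (Sup K) - f (Inf K))\<bar>
          \<le> e' * (Sup K - Inf K) + (if (x, K) \<in> q then \<bar>f (Sup K) - f (Inf K)\<bar> else 0)"
        if xK: "(x, K) \<in> p" for x K
      proof -
        define u v where "u = Inf K" and "v = Sup K"
        have uv: "K = {u..v}" "u \<le> x" "x \<le> v" "K \<subseteq> {a..b}" "K \<subseteq> ball x (r x)"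
          using K[OF xK] by (auto simp: u_def v_def)
        have content: "measure lborel K = v - u" using uv by simp
        show ?thesis
        proof (cases "x \<in> T")
          case True
          then have "(x, K) \<in> q" using xK by (simp add: q_def)
          then show ?thesis
            using True \<open>e' > 0\<close> uv
            by (simp add: D0_def u_def[symmetric] v_def[symmetric] abs_minus_commute)
        next
          case False
          have "u \<in> K" "v \<in> K" using uv by auto
          then have "\<bar>u - x\<bar> < r x" "\<bar>v - x\<bar> < r x"
            using uv(5) by (auto simp: dist_real_def)
          moreover have "x \<in> {a..b} - T" using False uv by auto
          ultimately have "\<bar>f u - f x - (u - x) * D x\<bar> \<le> e' * \<bar>u - x\<bar>"
            "\<bar>f v - f x - (v - x) * D x\<bar> \<le> e' * \<bar>v - x\<bar>"
            using r(3) by blast+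
          \<comment> \<open>Because the tag lies between \<open>u\<close> and \<open>v\<close>, the
            errors at the two ends add up to a multiple of the length of the interval.\<close>
          moreover have "e' * \<bar>u - x\<bar> + e' * \<bar>v - x\<bar> = e' * (v - u)"
            using uv by (simp add: algebra_simps)
          moreover have "(v - u) * D x - (f v - f u)
              = (f u - f x - (u - x) * D x) - (f v - f x - (v - x) * D x)"
            by (simp add: algebra_simps)
          ultimately have "\<bar>(v - u) * D x - (f v - f u)\<bar> \<le> e' * (v - u)"
            by linarith
          then show ?thesis
            using False content by (simp add: D0_def q_def u_def v_def)
        qed
      qed
      \<comment> \<open>The increments of \<open>f\<close> telescope over the division, so the error
        of the Riemann sum is a sum of local errors.\<close>
      have "(\<Sum>(x, K)\<in>p. measure lborel K *\<^sub>R D0 x) - (f b - f a)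
          = (\<Sum>(x, K)\<in>p. measure lborel K * D0 x - (f (Sup K) - f (Inf K)))"
        using additive_tagged_division_1[OF \<open>a \<le> b\<close> p, of f, symmetric]
        by (simp add: sum_subtractf case_prod_unfold)
      also have "\<bar>\<dots>\<bar> \<le> (\<Sum>(x, K)\<in>p. e' * (Sup K - Inf K)
          + (if (x, K) \<in> q then \<bar>f (Sup K) - f (Inf K)\<bar> else 0))"
        by (rule order_trans[OF sum_abs sum_mono]) (use bound in auto)
      also have "\<dots> = e' * (\<Sum>(x, K)\<in>p. Sup K - Inf K)
          + (\<Sum>z\<in>p. if z \<in> q then \<bar>f (Sup (snd z)) - f (Inf (snd z))\<bar> else 0)"
        by (simp add: sum.distrib sum_distrib_left case_prod_unfold)
      also have "(\<Sum>(x, K)\<in>p. Sup K - Inf K) = b - a"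
        using additive_tagged_division_1[OF \<open>a \<le> b\<close> p, of "\<lambda>x. x"] .
      also have "(\<Sum>z\<in>p. if z \<in> q then \<bar>f (Sup (snd z)) - f (Inf (snd z))\<bar> else 0)
          = (\<Sum>z\<in>q. \<bar>f (Sup (snd z)) - f (Inf (snd z))\<bar>)"
        using p'(1) \<open>q \<subseteq> p\<close> by (simp add: sum.If_cases Int_absorb1)
      also have "e' * (b - a) + \<dots> < e' * (b - a) + e / 2"
      proof -
        have disj: "{Inf (snd z)<..<Sup (snd z)} \<inter> {Inf (snd w)<..<Sup (snd w)} = {}"
          if "z \<in> q" "w \<in> q" "z \<noteq> w" for z w
        proof -
          obtain x K y L where zw: "z = (x, K)" "w = (y, L)" by fastforce
          have "interior K \<inter> interior L = {}"
            using p'(5)[of x K y L] that zw by (auto simp: q_def)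
          moreover have "interior K = {Inf K<..<Sup K}" "interior L = {Inf L<..<Sup L}"
            using K[of x K] K[of y L] that zw
            by (metis (no_types, lifting) interior_atLeastAtMost_real mem_Collect_eq q_def)+
          ultimately show ?thesis by (simp add: zw)
        qed
        \<comment> \<open>Fineness puts the interval into the ball around its exceptional tag, and
          that ball lies in \<open>U\<close>.\<close>
        have sub: "Inf (snd z) \<le> Sup (snd z) \<and> {Inf (snd z)..Sup (snd z)} \<subseteq> {a..b} \<inter> U"
          if zq: "z \<in> q" for z
        proof -
          obtain x L where z: "z = (x, L)" by fastforce
          have "(x, L) \<in> p" "x \<in> T" using zq z by (auto simp: q_def)
          from K[OF this(1)] r(2)[OF this(2)] show ?thesis
            unfolding z snd_conv by (metis dual_order.trans le_inf_iff)
        qed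
        then have q: "nonoverlapping_in ({a..b} \<inter> U) q (\<lambda>z. Inf (snd z)) (\<lambda>z. Sup (snd z))"
          using disj unfolding nonoverlapping_in_def by blast
        have "(\<Sum>z\<in>q. Sup (snd z) - Inf (snd z)) \<le> measure lebesgue U"
          using \<open>finite q\<close> U nonoverlapping_in_mono[OF q]
          by (intro nonoverlapping_in_sum_le_measure) auto
        also have "\<dots> < \<delta>" by (rule mU)
        finally have "(\<Sum>z\<in>q. \<bar>f (Sup (snd z)) - f (Inf (snd z))\<bar>) < e / 2"
          using \<open>finite q\<close> nonoverlapping_in_mono[OF q] by (intro \<delta>) auto
        then show ?thesis by simp
      qed
      also have "e' * (b - a) = e / 2"
        using \<open>a < b\<close> by (simp add: e'_def divide_simps)
      also have "e / 2 + e / 2 = e" by simp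
      finally show "norm ((\<Sum>(x, K)\<in>p. measure lborel K *\<^sub>R D0 x) - (f b - f a)) < e"
        by simp
    qed
  qed
  then show ?thesis
    by (rule has_integral_spike[OF T, rotated]) (simp add: D0_def)
qed

text \<open>
  On an interval shorter than the \<open>\<delta>\<close> belonging to \<open>\<epsilon> = 1\<close> the variation is at most \<open>1\<close>; finitely
  many such intervals cover \<open>{a..b}\<close>.
\<close>

lemma absolutely_integrable_abs_continuous:
  fixes f D :: "real \<Rightarrow> real"
  assumes "a \<le> b" and ac: "abs_continuous_on {a..b} f" and "negligible S"
    and deriv: "\<And>x. x \<in> {a<..<b} - S \<Longrightarrow> (f has_real_derivative D x) (at x)"
  shows "D absolutely_integrable_on {a..b}"
proof -
  have hi: "(D has_integral (f v - f u)) {u..v}" if "a \<le> u" "u \<le> v" "v \<le> b" for u v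
    using that by (intro has_integral_abs_continuous[OF _ _ \<open>negligible S\<close>])
      (auto intro: deriv abs_continuous_on_subset[OF ac])
  obtain \<delta> where "\<delta> > 0"
    and \<delta>: "\<And>(I :: real set set) x y. finite I \<Longrightarrow> nonoverlapping_in {a..b} I x y \<Longrightarrow>
      (\<Sum>k\<in>I. y k - x k) < \<delta> \<Longrightarrow> (\<Sum>k\<in>I. \<bar>f (y k) - f (x k)\<bar>) < 1"
    using abs_continuous_on_finite_family[OF ac zero_less_one] by blast
  have small: "D absolutely_integrable_on {u..v}" if uv: "a \<le> u" "u \<le> v" "v \<le> b" "v - u < \<delta>" for u v
  proof -
    have "D absolutely_integrable_on cbox u v"
    proof (rule bounded_variation_absolutely_integrable_interval[where B = 1])
      show "D integrable_on cbox u v" using hi[OF uv(1-3)] by auto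
      fix d assume d: "d division_of cbox u v"
      note d' = division_ofD[OF d]
      have K: "K = {Inf K..Sup K} \<and> Inf K \<le> Sup K \<and> K \<subseteq> {u..v}" if "K \<in> d" for K
        using d'(2,3,4)[OF that] by (auto simp: box_real)
      have disj: "{Inf K<..<Sup K} \<inter> {Inf L<..<Sup L} = {}" if "K \<in> d" "L \<in> d" "K \<noteq> L" for K L
        using d'(5)[OF that] K[OF that(1)] K[OF that(2)] by (metis interior_atLeastAtMost_real)
      have nd: "nonoverlapping_in {u..v} d Inf Sup"
        using K disj unfolding nonoverlapping_in_def by blast
      have "(\<Sum>K\<in>d. Sup K - Inf K) \<le> measure lebesgue {u..v}"
        using d'(1) nd by (intro nonoverlapping_in_sum_le_measure) auto
      also have "\<dots> < \<delta>" using uv by simp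
      finally have "(\<Sum>K\<in>d. \<bar>f (Sup K) - f (Inf K)\<bar>) < 1"
        using d'(1) nonoverlapping_in_mono[OF nd, of "{a..b}"] uv by (intro \<delta>) auto
      moreover have "(\<Sum>K\<in>d. norm (integral K D)) = (\<Sum>K\<in>d. \<bar>f (Sup K) - f (Inf K)\<bar>)"
      proof (rule sum.cong[OF refl])
        fix K' assume "K' \<in> d"
        define s t where "s = Inf K'" "t = Sup K'"
        have "K' = {s..t}" "s \<le> t" "{s..t} \<subseteq> {u..v}"
          using K[OF \<open>K' \<in> d\<close>] by (auto simp: s_t_def)
        then have "(D has_integral (f t - f s)) K'"
          using hi[of s t] uv by auto
        then show "norm (integral K' D) = \<bar>f (Sup K') - f (Inf K')\<bar>"
          by (simp add: integral_unique s_t_def)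
      qed
      ultimately show "(\<Sum>K\<in>d. norm (integral K D)) \<le> 1" by simp
    qed
    then show ?thesis by simp
  qed
  \<comment> \<open>The interval is exhausted by steps of length \<delta>/2, cut off at
    \<open>b\<close>. Halving meets the strict bound on the length in \<open>small\<close>.\<close>
  have "D absolutely_integrable_on {a..min b (a + real n * (\<delta> / 2))}" for n
  proof (induction n)
    case 0
    then show ?case using small[of a a] \<open>a \<le> b\<close> \<open>\<delta> > 0\<close> by simp
  next
    case (Suc n)
    define s t where "s = min b (a + real n * (\<delta> / 2))" "t = min b (a + real (Suc n) * (\<delta> / 2))"
    have st: "a \<le> s" "s \<le> t" "t \<le> b" "t - s < \<delta>"
      using \<open>a \<le> b\<close> \<open>\<delta> > 0\<close> add_pos_nonneg[of \<delta> "\<delta> * real n"]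
      by (auto simp: s_t_def field_simps min_def)
    have "D absolutely_integrable_on {a..s} \<union> {s..t}"
      using Suc small[OF st] by (intro set_integrable_Un) (auto simp: s_t_def)
    then show ?case
      using st by (simp add: ivl_disj_un_two_touch s_t_def)
  qed
  moreover obtain n where "(b - a) / (\<delta> / 2) < real n"
    using reals_Archimedean2 by blast
  then have "min b (a + real n * (\<delta> / 2)) = b"
    using \<open>\<delta> > 0\<close> by (simp add: field_simps min_def)
  ultimately show ?thesis by metis
qed

subsection \<open>Integration by parts for \<open>\<psi>\<^sub>1\<close>\<close>

text \<open>The function \<open>(1 - v) * H v\<close> is absolutely continuous with derivative
  \<open>(1 - v) * D v - H v\<close> almost everywhere, and adding the integral of \<open>H\<close>
  isolates the integrand of \<open>psi1\<close>. The weight vanishes up to \<open>a\<close>, so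
  integration starts at \<open>max a u\<close>.\<close>

lemma psi1_eq_integral:
  assumes H: "abs_continuous_on {a..1 - b} H"
    and D: "AE v in lebesgue. v \<in> {a<..<1 - b} \<longrightarrow> (H has_real_derivative D v) (at v)"
    and m: "m = max a u" "m \<le> 1 - b" "0 \<le> b"
  shows "psi1 a b D u = b * H (1 - b) - (1 - m) * H m + integral {m..1 - b} H"
proof -
  define c where "c = 1 - b"
  obtain N where N: "negligible N"
    "\<And>v. v \<in> {a<..<c} - N \<Longrightarrow> (H has_real_derivative D v) (at v)"
  proof -
    from D obtain N where "N \<in> null_sets lebesgue"
      "{v. \<not> (v \<in> {a<..<1 - b} \<longrightarrow> (H has_real_derivative D v) (at v))} \<subseteq> N"
      unfolding eventually_ae_filter by auto
    then show thesis
      by (intro that[of N]) (auto simp: negligible_iff_null_sets c_def)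
  qed
  have mc: "m \<le> c" "c \<le> 1" "a \<le> m" using m by (auto simp: c_def)
  have ac: "abs_continuous_on {m..c} (\<lambda>v. (1 - v) * H v)"
    using mc abs_continuous_on_subset[OF H, of "{m..c}"]
    by (intro abs_continuous_on_mult abs_continuous_on_one_minus) (auto simp: c_def)
  have deriv: "((\<lambda>v. (1 - v) * H v) has_real_derivative (1 - v) * D v - H v) (at v)"
    if "v \<in> {m<..<c} - N" for v
    using that mc by (auto intro!: derivative_eq_intros N(2))
  have Hc: "continuous_on {m..c} H"
    by (rule continuous_on_subset[OF abs_continuous_on_imp_continuous_on[OF H]])
      (use mc in \<open>auto simp: c_def\<close>)
  then have HI: "(H has_integral integral {m..c} H) {m..c}"
    by (simp add: integrable_continuous_interval integrable_integral)
  have "((\<lambda>v. ((1 - v) * D v - H v) + H v) has_integral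
      ((1 - c) * H c - (1 - m) * H m + integral {m..c} H)) {m..c}"
    by (rule has_integral_add[OF has_integral_abs_continuous[OF mc(1) ac N(1) deriv] HI])
  then have hi: "((\<lambda>v. (1 - v) * D v) has_integral
      (b * H c - (1 - m) * H m + integral {m..c} H)) {m..c}"
    by (simp add: c_def)
  have "(\<lambda>v. ((1 - v) * D v - H v) + H v) absolutely_integrable_on {m..c}"
    by (rule set_integral_add(1)[OF
        absolutely_integrable_abs_continuous[OF mc(1) ac N(1) deriv]
        absolutely_integrable_continuous_real[OF Hc]])
  then have ai: "(\<lambda>v. (1 - v) * D v) absolutely_integrable_on {m..c}"
    by simp
  \<comment> \<open>The weight has strict inequalities, so the integrand of \<open>psi1\<close> can
    differ from the one on the closed interval only at its two endpoints. Absolute integrability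
    passes across this null set and lets Lebesgue and gauge integrals be exchanged.\<close>
  let ?k = "\<lambda>v. indicat_real {u..1} v *\<^sub>R ((1 - v) * (wins_weight a b v * D v))"
  let ?k' = "\<lambda>v. indicat_real {m..c} v *\<^sub>R ((1 - v) * D v)"
  have ai': "?k' absolutely_integrable_on UNIV"
    using ai by (simp add: set_integrable_def)
  have mc_neg: "negligible {m, c}" by simp
  have eq: "?k v = ?k' v" if "v \<in> UNIV - {m, c}" for v
    using that m mc by (auto simp: wins_weight_def c_def indicator_def)
  have "psi1 a b D u = (LINT v:UNIV|lebesgue. ?k v)"
    by (simp add: psi1_def set_lebesgue_integral_def)
  also have "\<dots> = integral UNIV ?k"
    by (rule set_lebesgue_integral_eq_integral(2)[OF absolutely_integrable_spike[OF ai' mc_neg eq]])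
  also have "\<dots> = integral UNIV ?k'"
    using integral_spike[OF mc_neg eq] by (rule sym)
  also have "\<dots> = (LINT v:UNIV|lebesgue. ?k' v)"
    using set_lebesgue_integral_eq_integral(2)[OF ai'] by (rule sym)
  also have "\<dots> = (LINT v:{m..c}|lebesgue. (1 - v) * D v)"
    by (simp add: set_lebesgue_integral_def)
  also have "\<dots> = integral {m..c} (\<lambda>v. (1 - v) * D v)"
    by (rule set_lebesgue_integral_eq_integral(2)[OF ai])
  also have "\<dots> = b * H c - (1 - m) * H m + integral {m..c} H"
    using hi by (rule integral_unique)
  finally show ?thesis by (simp add: c_def)
qed

lemma psi1_eq_0:
  assumes "1 - b \<le> max a u"
  shows "psi1 a b D u = 0"
proof -
  have "indicat_real {u..1} v *\<^sub>R ((1 - v) * (wins_weight a b v * D v)) = 0" for v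
    using assms by (auto simp: wins_weight_def indicator_def)
  then show ?thesis
    unfolding psi1_def set_lebesgue_integral_def by (simp only: Bochner_Integration.integral_zero)
qed

section \<open>Integrals against the inverse-square weight\<close>

lemma has_integral_inverse_square:
  fixes p q :: real
  assumes "p \<le> q" "q < 1"
  shows "((\<lambda>u. (1 / (1 - u))\<^sup>2) has_integral (1 / (1 - q) - 1 / (1 - p))) {p..q}"
proof (rule fundamental_theorem_of_calculus[OF assms(1)])
  fix u assume "u \<in> {p..q}"
  with assms have "1 - u \<noteq> 0" by auto
  then show "((\<lambda>u. 1 / (1 - u)) has_vector_derivative (1 / (1 - u))\<^sup>2) (at u within {p..q})"
    unfolding has_real_derivative_iff_has_vector_derivative[symmetric]
    by (auto intro!: derivative_eq_intros simp: power2_eq_square)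
qed

text \<open>The common shape of the covariance integrands: both \<psi> factors are constant below
  \<open>a\<close>, and at least one vanishes beyond \<open>c\<close>. The first piece gives
  \<open>C * (1 / (1 - a) - 1)\<close>. Values at the breakpoints are irrelevant, and both
  \<open>a = c\<close> and \<open>c = 1\<close> are allowed.\<close>

lemma integral_piecewise:
  fixes f g :: "real \<Rightarrow> real"
  assumes a: "0 \<le> a" "a < 1" and c: "a \<le> c" "c \<le> 1"
    and f1: "\<And>u. 0 \<le> u \<Longrightarrow> u < a \<Longrightarrow> f u = C * (1 / (1 - u))\<^sup>2"
    and f2: "\<And>u. a < u \<Longrightarrow> u < c \<Longrightarrow> f u = g u"
    and f3: "\<And>u. c < u \<Longrightarrow> u < 1 \<Longrightarrow> f u = 0"
    and g: "g absolutely_integrable_on {a..c}" "(g has_integral I) {a..c}"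
  shows "f absolutely_integrable_on {0..<1}"
    and "(LINT u:{0..<1}|lebesgue. f u) = C * a / (1 - a) + I"
proof -
  have "((\<lambda>u. C * (1 / (1 - u))\<^sup>2) has_integral C * (1 / (1 - a) - 1 / (1 - 0))) {0..a}"
    by (rule has_integral_mult_right[OF has_integral_inverse_square[OF a]])
  also have "C * (1 / (1 - a) - 1 / (1 - 0)) = C * a / (1 - a)"
    using a by (simp add: field_simps)
  finally have i1: "((\<lambda>u. C * (1 / (1 - u))\<^sup>2) has_integral C * a / (1 - a)) {0..a}" .
  have a1: "(\<lambda>u. C * (1 / (1 - u))\<^sup>2) absolutely_integrable_on {0..a}"
    using a by (intro absolutely_integrable_continuous_real continuous_intros) auto
  have sp: "negligible {0, a, c, 1}" by simp
  have F: "f absolutely_integrable_on {0..a}" "(f has_integral C * a / (1 - a)) {0..a}"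
    "f absolutely_integrable_on {a..c}" "(f has_integral I) {a..c}"
    "f absolutely_integrable_on {c..1}" "(f has_integral 0) {c..1}"
  proof -
    have e: "f u = C * (1 / (1 - u))\<^sup>2" if "u \<in> {0..a} - {0, a, c, 1}" for u
      using that f1 by auto
    show "f absolutely_integrable_on {0..a}"
      using absolutely_integrable_spike[OF a1 sp e] .
    show "(f has_integral C * a / (1 - a)) {0..a}"
      using has_integral_spike[OF sp e i1] .
    have e: "f u = g u" if "u \<in> {a..c} - {0, a, c, 1}" for u
      using that f2 by auto
    show "f absolutely_integrable_on {a..c}"
      using absolutely_integrable_spike[OF g(1) sp e] .
    show "(f has_integral I) {a..c}"
      using has_integral_spike[OF sp e g(2)] .
    have e: "f u = 0" if "u \<in> {c..1} - {0, a, c, 1}" for u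
      using that f3 by auto
    show "f absolutely_integrable_on {c..1}"
      by (rule absolutely_integrable_spike[OF _ sp e]) simp_all
    show "(f has_integral 0) {c..1}"
      using has_integral_spike[OF sp e has_integral_0] .
  qed
  have "f absolutely_integrable_on {0..a} \<union> {a..c} \<union> {c..1}"
    using F by (intro set_integrable_Un) auto
  also have "{0..a} \<union> {a..c} \<union> {c..1} = {0..1}"
    using a c by auto
  finally have ai: "f absolutely_integrable_on {0..1}" .
  have hi: "(f has_integral C * a / (1 - a) + I) {0..1}"
    using has_integral_combine[OF _ _ has_integral_combine[OF _ _ F(2,4)] F(6)] a c by simp
  show *: "f absolutely_integrable_on {0..<1}"
    by (rule set_integrable_subset[OF ai]) auto
  have "(f has_integral C * a / (1 - a) + I) {0..<1}"
    using hi by (rule has_integral_spike_set_eq[THEN iffD1, rotated -1])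
      (auto intro: negligible_subset[of "{1}"])
  then show "(LINT u:{0..<1}|lebesgue. f u) = C * a / (1 - a) + I"
    using set_lebesgue_integral_eq_integral(2)[OF *] by (simp add: integral_unique)
qed

lemma V_integral_commute: "V_integral p q = V_integral q p"
  unfolding V_integral_def V_integrand_def by (simp add: ac_simps)

lemma V_integrand_commute: "V_integrand p q = V_integrand q p"
  unfolding V_integrand_def by (simp add: ac_simps)

section \<open>The tail function and its quotient by \<open>1 - u\<close>\<close>

text \<open>For \<open>0 \<le> b\<close> and \<open>u \<le> 1 - b\<close> this is the integral of
  \<open>H (min v (1 - b))\<close> over \<open>v\<close> from \<open>u\<close> to 1, that is, the
  upper tail integral of the winsorized function.\<close>

definition wins_tail :: "real \<Rightarrow> (real \<Rightarrow> real) \<Rightarrow> real \<Rightarrow> real" where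
  "wins_tail b H u = b * H (1 - b) + integral {u..1 - b} H"

lemma wins_tail_right [simp]: "wins_tail b H (1 - b) = b * H (1 - b)"
  by (simp add: wins_tail_def)

lemma psi1_eq_wins_tail:
  assumes "abs_continuous_on {a..1 - b} H"
    and "AE v in lebesgue. v \<in> {a<..<1 - b} \<longrightarrow> (H has_real_derivative D v) (at v)"
    and "0 \<le> b"
  shows "u \<in> {a..1 - b} \<Longrightarrow> psi1 a b D u = wins_tail b H u - (1 - u) * H u"
    and "u \<le> a \<Longrightarrow> a \<le> 1 - b \<Longrightarrow> psi1 a b D u = wins_tail b H a - (1 - a) * H a"
  using psi1_eq_integral[OF assms(1,2) refl, of u] assms(3)
  by (auto simp: wins_tail_def max_def)

lemma wins_tail_has_derivative:
  assumes "continuous_on {a..1 - b} H" and "u \<in> {a..1 - b}"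
  shows "(wins_tail b H has_real_derivative - H u) (at u within {a..1 - b})"
  unfolding wins_tail_def[abs_def]
  using integral_has_real_derivative'[OF assms]
  by (auto intro!: derivative_eq_intros)

text \<open>The point 1 belongs to the interval only if \<open>b = 0\<close>. Then the tail function
  vanishes at 1, and the quotient is minus its difference quotient there, with limit
  \<open>H 1\<close>.\<close>

lemma wins_tail_quotient_continuous:
  assumes H: "continuous_on {a..1 - b} H" and "0 \<le> b"
  shows "continuous_on {a..1 - b} (\<lambda>u. if u = 1 then H 1 else wins_tail b H u / (1 - u))"
  unfolding continuous_on_eq_continuous_within
proof
  fix u assume u: "u \<in> {a..1 - b}"
  note d = wins_tail_has_derivative[OF H u]
  show "continuous (at u within {a..1 - b}) (\<lambda>u. if u = 1 then H 1 else wins_tail b H u / (1 - u))"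
  proof (cases "u = 1")
    case True
    with u \<open>0 \<le> b\<close> have b: "b = 0" by auto
    have "((\<lambda>y. (wins_tail 0 H y - wins_tail 0 H 1) / (y - 1)) \<longlongrightarrow> - H 1) (at 1 within {a..1})"
      using d by (simp add: True b has_field_derivative_iff)
    then have "((\<lambda>y. - ((wins_tail 0 H y - wins_tail 0 H 1) / (y - 1))) \<longlongrightarrow> - (- H 1)) (at 1 within {a..1})"
      by (rule tendsto_minus)
    then have "((\<lambda>y. wins_tail 0 H y / (1 - y)) \<longlongrightarrow> H 1) (at 1 within {a..1})"
      using wins_tail_right[of 0 H] by (simp only: minus_divide_right) simp
    moreover have "\<forall>\<^sub>F y in at 1 within {a..1}.
        wins_tail 0 H y / (1 - y) = (if y = 1 then H 1 else wins_tail 0 H y / (1 - y))"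
      by (simp add: eventually_at_filter)
    ultimately have "((\<lambda>y. if y = 1 then H 1 else wins_tail 0 H y / (1 - y)) \<longlongrightarrow> H 1)
        (at 1 within {a..1})"
      by (rule Lim_transform_eventually)
    then show ?thesis
      unfolding continuous_within True b by simp
  next
    case False
    have "continuous (at u within {a..1 - b}) (\<lambda>u. wins_tail b H u / (1 - u))"
      using d False by (intro continuous_intros DERIV_continuous[OF d]) auto
    then show ?thesis
      \<comment> \<open>Within distance \<open>\<bar>u - 1\<bar>\<close> of \<open>u\<close> the
        exceptional point 1 is not met, so the two functions agree.\<close>
      by (rule continuous_transform_within[of _ _ _ "\<bar>u - 1\<bar>"]) (use False u in \<open>auto simp: dist_real_def\<close>)
  qed
qed

subsection \<open>The covariance integrals\<close>

lemma set_lebesgue_integral_continuous_interval: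
  fixes f :: "real \<Rightarrow> real"
  assumes "continuous_on {a..c} f"
  shows "(LINT v:{a..c}|lebesgue. f v) = integral {a..c} f"
  using absolutely_integrable_continuous_real[OF assms] by (rule set_lebesgue_integral_eq_integral)

text \<open>The data of one index; the mixed integrals interpret it once for each of their two
  functions.\<close>

locale winsorized =
  fixes a b :: real and H D :: "real \<Rightarrow> real"
  assumes range: "0 \<le> a" "a \<le> 1 - b" "0 \<le> b"
    and ac: "abs_continuous_on {a..1 - b} H"
    and deriv: "AE v in lebesgue. v \<in> {a<..<1 - b} \<longrightarrow> (H has_real_derivative D v) (at v)"
begin

lemma cont: "continuous_on {a..1 - b} H"
  using ac by (rule abs_continuous_on_imp_continuous_on)

lemmas psi1_eq = psi1_eq_wins_tail[OF ac deriv range(3)]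

lemma LINT_eq: "(LINT v:{a..1 - b}|lebesgue. H v) = integral {a..1 - b} H"
  using cont by (rule set_lebesgue_integral_continuous_interval)

lemma wins_mean_eq: "wins_mean a b H = a * H a + wins_tail b H a"
  by (simp add: wins_mean_def wins_tail_def LINT_eq)

lemma tail_deriv:
  assumes "a < u" "u < 1 - b"
  shows "(wins_tail b H has_real_derivative - H u) (at u)"
  using wins_tail_has_derivative[OF cont, of u] assms at_within_Icc_at[of a u "1 - b"] by simp

end

text \<open>Between \<open>a\<close> and \<open>1 - b\<close> each factor
  \<open>psi1 / (1 - u)\<close> equals \<open>G - H\<close> with \<open>G = K / (1 - u)\<close>. The
  product is the derivative of \<open>K1 * K2 / (1 - u)\<close> plus \<open>H1 * H2\<close>.
  Continuity of \<open>G\<close> makes it integrable even when \<open>b = 0\<close>.\<close>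

lemma V_psi1_psi1:
  assumes "winsorized a b H1 D1" "winsorized a b H2 D2" and "a < 1"
  shows "V_integrand (psi1 a b D1) (psi1 a b D2) absolutely_integrable_on {0..<1}"
    and "V_integral (psi1 a b D1) (psi1 a b D2) = a * H1 a * H2 a + b * H1 (1 - b) * H2 (1 - b)
      + (LINT v:{a..1 - b}|lebesgue. H1 v * H2 v) - wins_mean a b H1 * wins_mean a b H2"
proof -
  interpret W1: winsorized a b H1 D1 by fact
  interpret W2: winsorized a b H2 D2 by fact
  define K1 K2 where "K1 = wins_tail b H1" and "K2 = wins_tail b H2"
  define G1 G2 where "G1 = (\<lambda>u. if u = 1 then H1 1 else K1 u / (1 - u))"
    and "G2 = (\<lambda>u. if u = 1 then H2 1 else K2 u / (1 - u))"
  note range = W1.range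
  have G: "continuous_on {a..1 - b} G1" "continuous_on {a..1 - b} G2"
    using wins_tail_quotient_continuous[OF W1.cont range(3)]
      wins_tail_quotient_continuous[OF W2.cont range(3)]
    by (simp_all only: G1_def G2_def K1_def K2_def)
  let ?g = "\<lambda>u. (G1 u - H1 u) * (G2 u - H2 u)"
  \<comment> \<open>If \<open>b = 0\<close>, the junk value \<open>?R 1 = 0\<close> is also the limit of \<open>?R\<close> at \<open>1\<close>.\<close>
  let ?R = "\<lambda>u. K1 u * K2 u / (1 - u)"
  let ?C = "(K1 a - (1 - a) * H1 a) * (K2 a - (1 - a) * H2 a)"
  let ?I = "integral {a..1 - b} (\<lambda>v. H1 v * H2 v)"
  have HH: "continuous_on {a..1 - b} (\<lambda>v. H1 v * H2 v)"
    by (intro continuous_intros W1.cont W2.cont)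
  \<comment> \<open>The identity also holds at 1, where both sides are 0, so \<open>?R\<close>
    inherits continuity up to the endpoint.\<close>
  have "?R = (\<lambda>u. (1 - u) * G1 u * G2 u)"
    by (auto simp: G1_def G2_def fun_eq_iff)
  moreover have "continuous_on {a..1 - b} (\<lambda>u. (1 - u) * G1 u * G2 u)"
    by (intro continuous_intros G)
  ultimately have "continuous_on {a..1 - b} ?R" by (simp only:)
  moreover have "(?R has_vector_derivative ?g u - H1 u * H2 u) (at u)"
    if "u \<in> {a<..<1 - b}" for u
  proof -
    have u: "u < 1" "(K1 has_real_derivative - H1 u) (at u)" "(K2 has_real_derivative - H2 u) (at u)"
      using that range W1.tail_deriv W2.tail_deriv by (auto simp: K1_def K2_def)
    then have "(?R has_real_derivative
        ((- H1 u * K2 u + - H2 u * K1 u) * (1 - u) - K1 u * K2 u * (0 - 1)) / ((1 - u) * (1 - u))) (at u)"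
      by (intro DERIV_divide DERIV_mult DERIV_diff DERIV_ident DERIV_const) auto
    also have "((- H1 u * K2 u + - H2 u * K1 u) * (1 - u) - K1 u * K2 u * (0 - 1)) / ((1 - u) * (1 - u))
        = ?g u - H1 u * H2 u"
      using u by (simp add: G1_def G2_def divide_simps) (simp add: algebra_simps)
    finally show ?thesis
      by (simp add: has_real_derivative_iff_has_vector_derivative)
  qed
  ultimately have "((\<lambda>u. ?g u - H1 u * H2 u) has_integral ?R (1 - b) - ?R a) {a..1 - b}"
    by (intro fundamental_theorem_of_calculus_interior range(2)) auto
  moreover have "((\<lambda>v. H1 v * H2 v) has_integral ?I) {a..1 - b}"
    using HH by (simp add: integrable_continuous_interval integrable_integral)
  ultimately have "((\<lambda>u. ?g u - H1 u * H2 u + H1 u * H2 u) has_integral ?R (1 - b) - ?R a + ?I) {a..1 - b}"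
    by (rule has_integral_add)
  then have hi: "(?g has_integral ?R (1 - b) - ?R a + ?I) {a..1 - b}" by simp
  have ai: "?g absolutely_integrable_on {a..1 - b}"
    by (intro absolutely_integrable_continuous_real continuous_intros G W1.cont W2.cont)
  have f1: "V_integrand (psi1 a b D1) (psi1 a b D2) u = ?C * (1 / (1 - u))\<^sup>2" if "u < a" for u
    using that range W1.psi1_eq(2)[of u] W2.psi1_eq(2)[of u]
    by (simp add: V_integrand_def K1_def K2_def)
  have f2: "V_integrand (psi1 a b D1) (psi1 a b D2) u = ?g u" if "a < u" "u < 1 - b" for u
    using that range W1.psi1_eq(1)[of u] W2.psi1_eq(1)[of u]
    by (simp add: V_integrand_def K1_def K2_def G1_def G2_def divide_simps power2_eq_square)
      (simp add: mult.commute)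
  have f3: "V_integrand (psi1 a b D1) (psi1 a b D2) u = 0" if "1 - b < u" for u
    using that by (simp add: V_integrand_def psi1_eq_0)
  have "1 - b \<le> 1" using range by simp
  note res = integral_piecewise[OF range(1) \<open>a < 1\<close> range(2) this f1 f2 f3 ai hi]
  show "V_integrand (psi1 a b D1) (psi1 a b D2) absolutely_integrable_on {0..<1}"
    by (rule res(1))
  have "V_integral (psi1 a b D1) (psi1 a b D2) = ?C * a / (1 - a) + (?R (1 - b) - ?R a + ?I)"
    unfolding V_integral_def by (rule res(2))
  also have "?R (1 - b) = b * H1 (1 - b) * H2 (1 - b)"
    by (simp add: K1_def K2_def)
  \<comment> \<open>The terms in \<open>K1 a * K2 a\<close> have coefficients
    \<open>a / (1 - a)\<close> and \<open>- 1 / (1 - a)\<close>, which sum to -1; the rest completes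
    the product of the two means.\<close>
  also have "?C * a / (1 - a) + (b * H1 (1 - b) * H2 (1 - b) - ?R a + ?I)
      = a * H1 a * H2 a + b * H1 (1 - b) * H2 (1 - b) + ?I - (a * H1 a + K1 a) * (a * H2 a + K2 a)"
    using \<open>a < 1\<close> by (simp add: divide_simps) (simp add: algebra_simps)
  finally show "V_integral (psi1 a b D1) (psi1 a b D2)
      = a * H1 a * H2 a + b * H1 (1 - b) * H2 (1 - b)
      + (LINT v:{a..1 - b}|lebesgue. H1 v * H2 v) - wins_mean a b H1 * wins_mean a b H2"
    by (simp add: W1.wins_mean_eq W2.wins_mean_eq K1_def K2_def
        set_lebesgue_integral_continuous_interval[OF HH])
qed

text \<open>Beyond \<open>a\<close> the factor \<open>psi2\<close> vanishes, so only the constant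
  value \<open>P\<close> of the other factor below \<open>a\<close> matters. Each of the three
  \<psi> functions is constant there, so all five entries involving \<open>psi2\<close> follow from
  this.\<close>

lemma V_psi2:
  assumes a: "0 \<le> a" "a < 1" and p: "\<And>u. u < a \<Longrightarrow> p u = P"
  shows "V_integrand p (psi2 a b D) absolutely_integrable_on {0..<1}"
    and "V_integral p (psi2 a b D) = a\<^sup>2 * D a * P"
proof -
  have f: "V_integrand p (psi2 a b D) u = P * (a * (1 - a) * D a) * (1 / (1 - u))\<^sup>2" if "u < a" for u
    using that p by (simp add: V_integrand_def psi2_def)
  have f0: "V_integrand p (psi2 a b D) u = 0" if "a < u" for u
    using that by (simp add: V_integrand_def psi2_def)
  have "(\<lambda>_. 0 :: real) absolutely_integrable_on {a..a}" by simp
  note res = integral_piecewise[OF a order_refl less_imp_le[OF a(2)] f f0 f0 this has_integral_0]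
  show "V_integrand p (psi2 a b D) absolutely_integrable_on {0..<1}"
    by (rule res(1))
  show "V_integral p (psi2 a b D) = a\<^sup>2 * D a * P"
    using a res(2) by (simp add: V_integral_def power2_eq_square)
qed

lemma psi3_0: "psi3 a 0 D = (\<lambda>_. 0)"
  by (simp add: psi3_def fun_eq_iff)

lemma V_zero:
  "V_integrand p (\<lambda>_. 0) absolutely_integrable_on S" "V_integral p (\<lambda>_. 0) = 0"
  by (simp_all add: V_integral_def V_integrand_def[abs_def] set_lebesgue_integral_def)

text \<open>Up to \<open>1 - b\<close> the factor \<open>psi3\<close> is constant, so the task is to
  integrate \<open>psi1 / (1 - u)\<^sup>2\<close>, which has the antiderivative
  \<open>K / (1 - u)\<close> between \<open>a\<close> and \<open>1 - b\<close>.\<close>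

lemma V_psi1_psi3:
  assumes "winsorized a b H D" and "a < 1"
  shows "V_integrand (psi1 a b D) (psi3 a b D2) absolutely_integrable_on {0..<1}"
    and "V_integral (psi1 a b D) (psi3 a b D2) = b\<^sup>2 * D2 (1 - b) *
      ((1 - b) * H (1 - b) - a * H a - (LINT v:{a..1 - b}|lebesgue. H v))"
proof -
  interpret winsorized a b H D by fact
  have "V_integrand (psi1 a b D) (psi3 a b D2) absolutely_integrable_on {0..<1} \<and>
    V_integral (psi1 a b D) (psi3 a b D2) = b\<^sup>2 * D2 (1 - b) *
      ((1 - b) * H (1 - b) - a * H a - (LINT v:{a..1 - b}|lebesgue. H v))"
  \<comment> \<open>For \<open>b = 0\<close> the factor \<open>b\<^sup>2\<close> makes
    \<open>psi3\<close> vanish. Otherwise \<open>1 - b < 1\<close>, and the weight is bounded on the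
    range of integration.\<close>
  proof (cases "b = 0")
    case True
    then show ?thesis by (simp add: psi3_0 V_zero)
  next
    case False
    with range have b: "b > 0" by simp
    define K where "K = wins_tail b H"
    define e where "e = b\<^sup>2 * D2 (1 - b)"
    have K: "continuous_on {a..1 - b} K"
      unfolding K_def using wins_tail_has_derivative[OF cont] by (rule DERIV_continuous_on)
    let ?g = "\<lambda>u. e * ((1 / (1 - u))\<^sup>2 * (K u - (1 - u) * H u))"
    let ?R = "\<lambda>u. K u / (1 - u)"
    have "((\<lambda>u. (1 / (1 - u))\<^sup>2 * (K u - (1 - u) * H u)) has_integral ?R (1 - b) - ?R a) {a..1 - b}"
    proof (rule fundamental_theorem_of_calculus_interior[OF range(2)])
      show "continuous_on {a..1 - b} ?R"
        using b by (intro continuous_intros K) auto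
      fix u assume u: "u \<in> {a<..<1 - b}"
      then have "(K has_real_derivative - H u) (at u)" "1 - u \<noteq> 0"
        using tail_deriv b by (auto simp: K_def)
      then have "(?R has_real_derivative (- H u * (1 - u) - K u * (0 - 1)) / ((1 - u) * (1 - u))) (at u)"
        by (intro DERIV_divide DERIV_diff DERIV_ident DERIV_const) auto
      also have "(- H u * (1 - u) - K u * (0 - 1)) / ((1 - u) * (1 - u))
          = (1 / (1 - u))\<^sup>2 * (K u - (1 - u) * H u)"
        by (simp add: power2_eq_square)
      finally show "(?R has_vector_derivative (1 / (1 - u))\<^sup>2 * (K u - (1 - u) * H u)) (at u)"
        by (simp add: has_real_derivative_iff_has_vector_derivative)
    qed
    then have hi: "(?g has_integral e * (?R (1 - b) - ?R a)) {a..1 - b}"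
      by (rule has_integral_mult_right)
    have ai: "?g absolutely_integrable_on {a..1 - b}"
      using b by (intro absolutely_integrable_continuous_real continuous_intros K cont) auto
    let ?C = "e * (K a - (1 - a) * H a)"
    have f1: "V_integrand (psi1 a b D) (psi3 a b D2) u = ?C * (1 / (1 - u))\<^sup>2" if "u < a" for u
      using that range psi1_eq(2)[of u] by (simp add: V_integrand_def psi3_def e_def K_def)
    have f2: "V_integrand (psi1 a b D) (psi3 a b D2) u = ?g u" if "a < u" "u < 1 - b" for u
      using that range psi1_eq(1)[of u] by (simp add: V_integrand_def psi3_def e_def K_def)
    have f3: "V_integrand (psi1 a b D) (psi3 a b D2) u = 0" if "1 - b < u" for u
      using that by (simp add: V_integrand_def psi1_eq_0)
    have "1 - b \<le> 1" using range by simp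
    note res = integral_piecewise[OF range(1) \<open>a < 1\<close> range(2) this f1 f2 f3 ai hi]
    have "V_integral (psi1 a b D) (psi3 a b D2) = ?C * a / (1 - a) + e * (?R (1 - b) - ?R a)"
      unfolding V_integral_def by (rule res(2))
    also have "?R (1 - b) = H (1 - b)"
      using b by (simp add: K_def)
    also have "?C * a / (1 - a) + e * (H (1 - b) - ?R a) = e * (H (1 - b) - a * H a - K a)"
      using \<open>a < 1\<close> by (simp add: divide_simps) (simp add: algebra_simps)
    also have "H (1 - b) - a * H a - K a
        = (1 - b) * H (1 - b) - a * H a - (LINT v:{a..1 - b}|lebesgue. H v)"
      by (simp add: K_def wins_tail_def LINT_eq algebra_simps)
    finally show ?thesis
      using res(1) by (simp add: e_def)
  qed
  then show "V_integrand (psi1 a b D) (psi3 a b D2) absolutely_integrable_on {0..<1}"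
    and "V_integral (psi1 a b D) (psi3 a b D2) = b\<^sup>2 * D2 (1 - b) *
      ((1 - b) * H (1 - b) - a * H a - (LINT v:{a..1 - b}|lebesgue. H v))"
    by blast+
qed

text \<open>For \<open>b > 0\<close> both factors are constant up to \<open>1 - b\<close> and vanish
  afterwards. The piecewise formula with breakpoint \<open>1 - b\<close> multiplies
  \<open>b^4\<close> by \<open>(1 - b) / b\<close>.\<close>

lemma V_psi3_psi3:
  assumes "0 \<le> b" "b \<le> 1"
  shows "V_integrand (psi3 a b D1) (psi3 a b D2) absolutely_integrable_on {0..<1}"
    and "V_integral (psi3 a b D1) (psi3 a b D2) = b^3 * (1 - b) * D1 (1 - b) * D2 (1 - b)"
proof -
  have "V_integrand (psi3 a b D1) (psi3 a b D2) absolutely_integrable_on {0..<1} \<and>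
    V_integral (psi3 a b D1) (psi3 a b D2) = b^3 * (1 - b) * D1 (1 - b) * D2 (1 - b)"
  proof (cases "b = 0")
    case True
    then show ?thesis by (simp add: psi3_0 V_zero)
  next
    case False
    with assms have c: "0 \<le> 1 - b" "1 - b < 1" by auto
    have f: "V_integrand (psi3 a b D1) (psi3 a b D2) u =
        (b^4 * D1 (1 - b) * D2 (1 - b)) * (1 / (1 - u))\<^sup>2" if "u < 1 - b" for u
      using that by (simp add: V_integrand_def psi3_def)
    have f0: "V_integrand (psi3 a b D1) (psi3 a b D2) u = 0" if "1 - b < u" for u
      using that by (simp add: V_integrand_def psi3_def)
    have "(\<lambda>_. 0 :: real) absolutely_integrable_on {1 - b..1 - b}" by simp
    note res = integral_piecewise[OF c order_refl less_imp_le[OF c(2)] f f0 f0 this has_integral_0]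
    show ?thesis
      using False res by (simp add: V_integral_def power2_eq_square eval_nat_numeral)
  qed
  then show "V_integrand (psi3 a b D1) (psi3 a b D2) absolutely_integrable_on {0..<1}"
    and "V_integral (psi3 a b D1) (psi3 a b D2) = b^3 * (1 - b) * D1 (1 - b) * D2 (1 - b)"
    by blast+
qed

section \<open>The degenerate case and the nine entries together\<close>

text \<open>For \<open>a = 1\<close>, \<open>b = 0\<close> the weight has empty support, and the
  factors \<open>1 - a\<close> and \<open>b\<^sup>2\<close> remove the other two functions. This
  covers the case in which \<open>1 / (1 - a)\<close> is meaningless.\<close>

lemma psi_one_zero: "psi s 1 0 D = (\<lambda>_. 0)"
  by (auto simp: psi_def psi1_eq_0 psi2_def psi3_def fun_eq_iff)

theorem corollary3:
  fixes M :: "real measure" and F :: "real \<Rightarrow> real"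
    and k i j :: nat
    and h H H' :: "nat \<Rightarrow> real \<Rightarrow> real"
    and ap bp :: "nat \<Rightarrow> real"
    and a b abar bbar :: real
    and V :: "nat \<Rightarrow> nat \<Rightarrow> real" and \<Delta> :: "nat \<Rightarrow> real"
  assumes M: "real_distribution M" and F: "F = cdf M"
    and ij: "i \<in> {1..k}" "j \<in> {1..k}"
    and H: "\<And>r. H r = qcomp F (h r)"
    and props: "a = ap i" "ap i = ap j" "b = bp i" "bp i = bp j"
    and range: "0 \<le> a" "a \<le> 1 - b" "1 - b \<le> 1"
    and bars: "abar = 1 - a" "bbar = 1 - b"
    and ac: "\<And>r. r \<in> {i, j} \<Longrightarrow> abs_continuous_on {a..bbar} (H r)"
    and deriv_ae: "\<And>r. r \<in> {i, j} \<Longrightarrow>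
      AE v in lebesgue. v \<in> {a<..<bbar} \<longrightarrow> (H r has_real_derivative H' r v) (at v)"
    and deriv_a: "\<And>r. r \<in> {i, j} \<Longrightarrow>
      (H r has_real_derivative H' r a) (at a within {0..1})"
    and deriv_b: "\<And>r. r \<in> {i, j} \<Longrightarrow>
      (H r has_real_derivative H' r bbar) (at bbar within {0..1})"
    and V: "\<And>s t. V s t =
      V_integral (psi s (ap i) (bp i) (H' i)) (psi t (ap j) (bp j) (H' j))"
    and \<Delta>: "\<And>r. \<Delta> r = wins_mean a b (H r)"
  shows "(\<forall>s\<in>{1..3}. \<forall>t\<in>{1..3}. set_integrable lebesgue {0..<1}
            (V_integrand (psi s (ap i) (bp i) (H' i)) (psi t (ap j) (bp j) (H' j)))) \<and>
    V 1 1 = a * H i a * H j a + b * H i bbar * H j bbar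
              + (LINT v:{a..bbar}|lebesgue. H i v * H j v) - \<Delta> i * \<Delta> j \<and>
    V 1 2 = a\<^sup>2 * H' j a * (b * H i bbar - abar * H i a + (LINT v:{a..bbar}|lebesgue. H i v)) \<and>
    V 1 3 = b\<^sup>2 * H' j bbar * (bbar * H i bbar - a * H i a - (LINT v:{a..bbar}|lebesgue. H i v)) \<and>
    V 2 1 = a\<^sup>2 * H' i a * (b * H j bbar - abar * H j a + (LINT v:{a..bbar}|lebesgue. H j v)) \<and>
    V 2 2 = a^3 * abar * H' i a * H' j a \<and>
    V 2 3 = a\<^sup>2 * b\<^sup>2 * H' i a * H' j bbar \<and>
    V 3 1 = b\<^sup>2 * H' i bbar * (bbar * H j bbar - a * H j a - (LINT v:{a..bbar}|lebesgue. H j v)) \<and>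
    V 3 2 = a\<^sup>2 * b\<^sup>2 * H' j a * H' i bbar \<and>
    V 3 3 = b^3 * bbar * H' i bbar * H' j bbar"
proof -
  have params: "ap i = a" "bp i = b" "ap j = a" "bp j = b"
    using props by auto
  have W: "winsorized a b (H r) (H' r)" if "r \<in> {i, j}" for r
    using range ac[OF that] deriv_ae[OF that] by unfold_locales (auto simp: bars)
  show ?thesis
  proof (cases "a = 1")
    case True
    with range have b: "b = 0" by simp
    have "(LINT v:{1}|lebesgue. f v) = 0" for f :: "real \<Rightarrow> real"
      using set_lebesgue_integral_continuous_interval[of 1 1 f] by simp
    \<comment> \<open>All nine integrals vanish. So do the right-hand sides: each \<Delta> reduces
      to \<open>H r 1\<close>, so the two products in the first formula cancel, and the others
      contain a factor that is 0.\<close>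
    then show ?thesis
      by (simp add: V \<Delta> params bars True b psi_one_zero V_zero wins_mean_def)
  next
    case False
    with range have a: "0 \<le> a" "a < 1" and b: "0 \<le> b" "b \<le> 1" by auto
    note Wi = W[of i, simplified] and Wj = W[of j, simplified]
    have P: "psi1 a b (H' r) u = b * H r (1 - b) - (1 - a) * H r a
        + (LINT v:{a..1 - b}|lebesgue. H r v)" if "r \<in> {i, j}" "u < a" for r u
      using winsorized.psi1_eq(2)[OF W[OF that(1)], of u] that(2) range
        winsorized.LINT_eq[OF W[OF that(1)]]
      by (simp add: wins_tail_def)
    have P2: "psi2 a b (H' r) u = a * (1 - a) * H' r a" if "u < a" for r u
      using that by (simp add: psi2_def)
    have P3: "psi3 a b (H' r) u = b\<^sup>2 * H' r (1 - b)" if "u < a" for r u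
      using that range by (simp add: psi3_def)
    \<comment> \<open>Here \<open>psi2\<close> is always the second factor, so the entries (2,1) and
      (2,3) are used through symmetry of the integral; the same is done for (3,1).\<close>
    note V12 = V_psi2[OF a P[of i]] and V21 = V_psi2[OF a P[of j]]
      and V22 = V_psi2[OF a P2[of _ i]]
      and V32 = V_psi2[OF a P3[of _ i]] and V23 = V_psi2[OF a P3[of _ j]]
    note V11 = V_psi1_psi1[OF Wi Wj a(2)]
      and V13 = V_psi1_psi3[OF Wi a(2)] and V31 = V_psi1_psi3[OF Wj a(2)]
      and V33 = V_psi3_psi3[OF b]
    have psi: "psi 1 = psi1" "psi 2 = psi2" "psi 3 = psi3"
      by (simp_all add: psi_def)
    have three: "{1..3} = {1, 2, 3 :: nat}" by auto
    have "set_integrable lebesgue {0..<1} (V_integrand (psi s a b (H' i)) (psi t a b (H' j)))"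
      if "s \<in> {1, 2, 3}" "t \<in> {1, 2, 3}" for s t
      using that V11(1) V12(1) V13(1) V21(1) V22(1) V23(1) V31(1) V32(1) V33(1)
      by (auto simp: psi psi[unfolded One_nat_def]
          V_integrand_commute[of "psi2 a b (H' i)" "psi1 a b (H' j)"]
          V_integrand_commute[of "psi2 a b (H' i)" "psi3 a b (H' j)"]
          V_integrand_commute[of "psi3 a b (H' i)" "psi1 a b (H' j)"])
    then have "\<forall>s\<in>{1..3}. \<forall>t\<in>{1..3}. set_integrable lebesgue {0..<1}
        (V_integrand (psi s (ap i) (bp i) (H' i)) (psi t (ap j) (bp j) (H' j)))"
      by (simp only: params three) blast
    moreover have "V 1 1 = a * H i a * H j a + b * H i bbar * H j bbar
        + (LINT v:{a..bbar}|lebesgue. H i v * H j v) - \<Delta> i * \<Delta> j"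
      by (simp only: V psi params bars \<Delta> V11(2))
    moreover have "V 1 2 = a\<^sup>2 * H' j a *
        (b * H i bbar - abar * H i a + (LINT v:{a..bbar}|lebesgue. H i v))"
      by (simp only: V psi params bars) (rule V12(2), simp_all)
    moreover have "V 1 3 = b\<^sup>2 * H' j bbar *
        (bbar * H i bbar - a * H i a - (LINT v:{a..bbar}|lebesgue. H i v))"
      by (simp only: V psi params bars V13(2))
    moreover have "V 2 1 = a\<^sup>2 * H' i a *
        (b * H j bbar - abar * H j a + (LINT v:{a..bbar}|lebesgue. H j v))"
      by (simp only: V psi params bars V_integral_commute[of "psi2 _ _ _"]) (rule V21(2), simp_all)
    moreover have "V 2 2 = a^3 * abar * H' i a * H' j a"
      by (simp only: V psi params bars V22(2)) (simp add: power2_eq_square power3_eq_cube)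
    moreover have "V 2 3 = a\<^sup>2 * b\<^sup>2 * H' i a * H' j bbar"
      by (simp only: V psi params bars V_integral_commute[of "psi2 _ _ _"] V23(2)) simp
    moreover have "V 3 1 = b\<^sup>2 * H' i bbar *
        (bbar * H j bbar - a * H j a - (LINT v:{a..bbar}|lebesgue. H j v))"
      by (simp only: V psi params bars V_integral_commute[of "psi3 _ _ _"] V31(2))
    moreover have "V 3 2 = a\<^sup>2 * b\<^sup>2 * H' j a * H' i bbar"
      by (simp only: V psi params bars V32(2)) simp
    moreover have "V 3 3 = b^3 * bbar * H' i bbar * H' j bbar"
      by (simp only: V psi params bars V33(2))
    ultimately show ?thesis by blast
  qed
qed

end
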